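(* Let $q$ be a power of a prime, let $m$ be a positive integer, and let $N$ be a positive divisor of $q^m-1$. If every prime divisor of $N$ divides $Q = (q^m-1)/(q-1)$, then, for every element $c \in \mathbb{F}_q\setminus\{0\}$, the number $Z_{q,m,N}(c)$ of $N$-free elements $\xi \in \mathbb{F}_{q^m}$ satisfying $\operatorname{Tr}_{\mathbb{F}_{q^m}/\mathbb{F}_q}(\xi) = c$ is given by $$Z_{q,m,N}(c) = \frac{\frac{q^m-1}{N}\phi(N) - Z_{q,m,N}(0)}{q-1}.$$
   Context: $\phi$ is Euler's function. For a positive divisor $N$ of $q^m-1$, a non-zero element $\xi \in \mathbb{F}_{q^m}^*$ is called $N$-free if, for any $d \mid N$, $\xi = \gamma^d$ with $\gamma \in \mathbb{F}_{q^m}$ implies $d=1$; equivalently $\xi = \alpha^k$ for some integer $k$ coprime to $N$, where $\alpha$ is a primitive element of $\mathbb{F}_{q^m}$. For $c \in \mathbb{F}_q$ (including $c=0$), $Z_{q,m,N}(c)$ denotes the number of $N$-free elements $\xi \in \mathbb{F}_{q^m}^*$ with $\operatorname{Tr}_{\mathbb{F}_{q^m}/\mathbb{F}_q}(\xi) = c$. *)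

theory Defs
  imports
    "HOL-Algebra.Algebra"
    "HOL-Number_Theory.Totient"
    "HOL-Number_Theory.Prime_Powers"
begin

(* N is meant to be a positive divisor of the order of the multiplicative group of L. *)
definition N_free :: "('a, 'b) ring_scheme \<Rightarrow> nat \<Rightarrow> 'a \<Rightarrow> bool" where
  "N_free L N \<xi> \<longleftrightarrow>
     \<xi> \<in> carrier L - {\<zero>\<^bsub>L\<^esub>} \<and>
     (\<forall>d::nat. \<forall>\<gamma>\<in>carrier L. d dvd N \<longrightarrow> \<xi> = \<gamma> [^]\<^bsub>L\<^esub> d \<longrightarrow> d = 1)"

(* The trace from the field L of order q ^ m to its subfield of order q,
   as the sum of the m conjugates of an element under the Frobenius map x \<mapsto> x ^ q. *)
definition ff_trace :: "('a, 'b) ring_scheme \<Rightarrow> nat \<Rightarrow> nat \<Rightarrow> 'a \<Rightarrow> 'a" where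
  "ff_trace L q m \<xi> = (\<Oplus>\<^bsub>L\<^esub>i\<in>{..<m}. \<xi> [^]\<^bsub>L\<^esub> (q ^ i))"

definition Z_free :: "('a, 'b) ring_scheme \<Rightarrow> nat \<Rightarrow> nat \<Rightarrow> nat \<Rightarrow> 'a \<Rightarrow> nat" where
  "Z_free L q m N c = card {\<xi> \<in> carrier L. N_free L N \<xi> \<and> ff_trace L q m \<xi> = c}"

end

theory Submission
  imports Defs
begin

text \<open>
  Write \<open>M = q ^ m - 1\<close> and \<open>Q = M / (q - 1)\<close>. The theorem says that the \<open>N\<close>-free elements of nonzero
  trace are equidistributed over the \<open>q - 1\<close> possible trace values. The symmetry behind this is
  multiplication by \<open>K - {0}\<close>: the trace is \<open>K\<close>-linear, so \<open>\<xi> \<mapsto> a\<xi>\<close> carries elements of trace \<open>b\<close> to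
  elements of trace \<open>ab\<close>, and the nonzero elements of \<open>K\<close> act transitively on themselves.

  The hypothesis on the primes of \<open>N\<close> makes this action preserve \<open>N\<close>-freeness
  (\<open>N_free_subfield_mult\<close>). Fix a primitive element \<open>\<alpha>\<close>. A power \<open>\<alpha> ^ k\<close> is \<open>N\<close>-free exactly when \<open>k\<close> is
  coprime to \<open>N\<close> (\<open>N_free_generator_pow_iff\<close>), and \<open>a ^ (q - 1) = 1\<close> forces \<open>a = \<alpha> ^ i\<close> with \<open>Q\<close> dividing
  \<open>i\<close>. Multiplication by \<open>a\<close> thus shifts the exponent by a number divisible by every prime of \<open>N\<close>,
  which does not affect coprimality.

  The formula follows by counting all \<open>N\<close>-free elements in two ways. The exponent criterion gives
  \<open>(M / N) \<phi>(N)\<close> (\<open>card_N_free\<close>). Sorting by trace gives \<open>Z(0) + (q - 1) Z(c)\<close>, provided that the trace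
  takes values in \<open>K\<close> (\<open>ff_trace_mem_subfield\<close>): raising the sum of the conjugates to the power \<open>q\<close>
  permutes them cyclically, so the trace is a fixed point of the Frobenius map, and \<open>K\<close> contains all
  of these. That argument needs the additivity of the Frobenius map, which comes from the binomial
  expansion in characteristic \<open>p\<close>.
\<close>

(* The product of ideals also reads "[k] \<cdot> x", namely as a product with a one-element list; without its
   notation, "[k] \<cdot> x" is only the k-fold sum of x. *)
no_notation ideal_prod (infixl \<open>\<cdot>\<index>\<close> 80)

section \<open>Counting integers coprime to a modulus\<close>

text \<open>
  Coprimality to \<open>N\<close> is periodic with period \<open>N\<close>. The interval starts at 1 rather than 0 to match
  \<^const>\<open>totatives\<close>, so that the case \<open>N = 1\<close> needs no special treatment.
\<close>
lemma card_coprime_upto_multiple: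
  fixes N t :: nat
  shows "card {k \<in> {0<..N * t}. coprime k N} = t * totient N"
proof (induction t)
  case 0
  show ?case by simp
next
  case (Suc t)
  have split: "{k \<in> {0<..N * Suc t}. coprime k N} =
      {k \<in> {0<..N * t}. coprime k N} \<union> (\<lambda>k. k + N * t) ` totatives N" (is "?A = ?B \<union> ?C")
  proof (intro Set.set_eqI iffI)
    fix k assume k: "k \<in> ?A"
    show "k \<in> ?B \<union> ?C"
    proof (cases "k \<le> N * t")
      case False
      then obtain j where j: "k = j + N * t" "j > 0"
        by (metis add.commute less_imp_add_positive not_le)
      moreover have "coprime j N"
        using k j(1) by (metis (no_types, lifting) coprime_iff_gcd_eq_1 gcd.commute gcd_add_mult
            add.commute mult.commute mem_Collect_eq)
      ultimately show ?thesis
        using k by (auto simp: in_totatives_iff)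
    qed (use k in auto)
  next
    fix k assume "k \<in> ?B \<union> ?C"
    then show "k \<in> ?A"
    proof
      assume "k \<in> ?C"
      then obtain j where j: "k = j + N * t" "j > 0" "j \<le> N" "coprime j N"
        by (auto simp: in_totatives_iff)
      then have "coprime k N"
        by (metis (no_types, lifting) coprime_iff_gcd_eq_1 gcd.commute gcd_add_mult
            add.commute mult.commute)
      with j show ?thesis by auto
    qed auto
  qed
  have "card ?C = totient N"
    unfolding totient_def by (intro card_image inj_onI) auto
  moreover have "?B \<inter> ?C = {}"
    by (auto simp: in_totatives_iff)
  ultimately show ?case
    unfolding split using Suc.IH by (subst card_Un_disjoint) auto
qed


section \<open>Additivity of the Frobenius map\<close>

lemma (in cring) binomial_expansion:
  assumes x: "x \<in> carrier R" and y: "y \<in> carrier R"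
  shows "(x \<oplus> y) [^] n = (\<Oplus>k\<in>{..n}. [(n choose k)] \<cdot> (x [^] k \<otimes> y [^] (n - k)))"
proof (induction n)
  case 0
  show ?case using x y by simp
next
  case (Suc n)
  define f where "f k = [(n choose k)] \<cdot> (x [^] k \<otimes> y [^] (n - k))" for k
  define g where "g k = x [^] k \<otimes> y [^] (Suc n - k)" for k
  (* The coefficient that multiplication by x moves to place k: Pascal's rule is
     u k + (n choose k) = Suc n choose k, also at k = 0. *)
  define u where "u k = (case k of 0 \<Rightarrow> 0 | Suc j \<Rightarrow> n choose j)" for k
  have f: "f k \<in> carrier R" and g: "g k \<in> carrier R" for k
    using x y by (simp_all add: f_def g_def)
  have fx: "f k \<otimes> x = [(u (Suc k))] \<cdot> g (Suc k)" for k
    using x y by (simp add: f_def g_def u_def add_pow_rdistr add_pow_ldistr m_ac)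
  have fy: "f k \<otimes> y = [(n choose k)] \<cdot> g k" if "k \<le> n" for k
    using x y that by (simp add: f_def g_def add_pow_rdistr add_pow_ldistr m_ac Suc_diff_le)
  have "(\<Oplus>k\<in>{..n}. f k) \<otimes> x = (\<Oplus>k\<in>{..n}. [(u (Suc k))] \<cdot> g (Suc k))"
    using f x by (simp add: finsum_ldistr Pi_def fx)
  also have "\<dots> = (\<Oplus>k\<in>{..Suc n}. [(u k)] \<cdot> g k)"
    using g by (subst add.finprod_Suc2) (simp_all add: u_def Pi_def)
  finally have sx: "(\<Oplus>k\<in>{..n}. f k) \<otimes> x = (\<Oplus>k\<in>{..Suc n}. [(u k)] \<cdot> g k)" .
  have "(\<Oplus>k\<in>{..n}. f k) \<otimes> y = (\<Oplus>k\<in>{..n}. f k \<otimes> y)"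
    using f y by (simp add: finsum_ldistr Pi_def)
  also have "\<dots> = (\<Oplus>k\<in>{..n}. [(n choose k)] \<cdot> g k)"
    using fy g by (intro add.finprod_cong') auto
  also have "\<dots> = (\<Oplus>k\<in>{..Suc n}. [(n choose k)] \<cdot> g k)"
    using g by (simp add: Pi_def binomial_eq_0)
  finally have sy: "(\<Oplus>k\<in>{..n}. f k) \<otimes> y = (\<Oplus>k\<in>{..Suc n}. [(n choose k)] \<cdot> g k)" .
  have Pascal: "u k + (n choose k) = Suc n choose k" for k
    by (cases k) (simp_all add: u_def)
  have "(x \<oplus> y) [^] Suc n = (\<Oplus>k\<in>{..n}. f k) \<otimes> x \<oplus> (\<Oplus>k\<in>{..n}. f k) \<otimes> y"
    using Suc.IH x y f by (simp add: f_def r_distr)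
  also have "\<dots> = (\<Oplus>k\<in>{..Suc n}. [(u k)] \<cdot> g k \<oplus> [(n choose k)] \<cdot> g k)"
    unfolding sx sy using g by (subst add.finprod_multf) auto
  also have "\<dots> = (\<Oplus>k\<in>{..Suc n}. [(Suc n choose k)] \<cdot> g k)"
    using g by (intro add.finprod_cong') (auto simp: add.nat_pow_mult Pascal)
  finally show ?case by (simp add: g_def)
qed

text \<open>
  All inner binomial coefficients \<open>p choose k\<close> are multiples of the prime \<open>p\<close>, hence vanish in the ring.
\<close>
lemma (in cring) Frobenius_prime_add:
  assumes p: "Factorial_Ring.prime (p::nat)" and char: "[p] \<cdot> \<one> = \<zero>"
    and x: "x \<in> carrier R" and y: "y \<in> carrier R"
  shows "(x \<oplus> y) [^] p = x [^] p \<oplus> y [^] p"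
proof -
  define g where "g k = [(p choose k)] \<cdot> (x [^] k \<otimes> y [^] (p - k))" for k
  have g: "g k \<in> carrier R" for k
    using x y by (simp add: g_def)
  have mult_p: "[p] \<cdot> z = \<zero>" if "z \<in> carrier R" for z
    using that add_pow_ldistr[of \<one> z p] char by simp
  have "g k = \<zero>" if "k \<in> {..p} - {0, p}" for k
  proof -
    have "p dvd (p choose k)"
      using that p by (intro dvd_choose_prime) (auto simp: prime_gt_0_nat)
    then obtain c where "p choose k = p * c" ..
    then show ?thesis
      using x y mult_p by (simp add: g_def add.nat_pow_pow[symmetric])
  qed
  then have "(\<Oplus>k\<in>{0, p}. g k) = (\<Oplus>k\<in>{..p}. g k)"
    using g by (intro add.finprod_mono_neutral_cong_left) auto
  also have "\<dots> = (x \<oplus> y) [^] p"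
    using binomial_expansion[OF x y] by (simp add: g_def)
  finally have "(x \<oplus> y) [^] p = g 0 \<oplus> g p"
    using g p by (simp add: Pi_def)
  also have "\<dots> = x [^] p \<oplus> y [^] p"
    using x y by (simp add: g_def a_comm)
  finally show ?thesis .
qed

lemma (in cring) Frobenius_power_add:
  assumes p: "Factorial_Ring.prime (p::nat)" and char: "[p] \<cdot> \<one> = \<zero>"
    and x: "x \<in> carrier R" and y: "y \<in> carrier R"
  shows "(x \<oplus> y) [^] (p ^ k) = x [^] (p ^ k) \<oplus> y [^] (p ^ k)"
proof (induction k)
  case 0
  show ?case using x y by simp
next
  case (Suc k)
  have "(x \<oplus> y) [^] (p ^ Suc k) = ((x \<oplus> y) [^] (p ^ k)) [^] p"
    using x y by (simp add: nat_pow_pow mult.commute)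
  also have "\<dots> = (x [^] (p ^ k)) [^] p \<oplus> (y [^] (p ^ k)) [^] p"
    using x y by (simp add: Suc.IH Frobenius_prime_add[OF p char])
  also have "\<dots> = x [^] (p ^ Suc k) \<oplus> y [^] (p ^ Suc k)"
    using x y by (simp add: nat_pow_pow mult.commute)
  finally show ?case .
qed

lemma (in cring) Frobenius_power_finsum:
  assumes p: "Factorial_Ring.prime (p::nat)" and char: "[p] \<cdot> \<one> = \<zero>"
    and "finite A" and "f \<in> A \<rightarrow> carrier R"
  shows "(\<Oplus>i\<in>A. f i) [^] (p ^ k) = (\<Oplus>i\<in>A. f i [^] (p ^ k))"
  using assms(3,4)
proof (induction A)
  case empty
  show ?case using p by (simp add: nat_pow_zero prime_gt_0_nat)
next
  case (insert a A)
  then show ?case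
    by (simp add: Pi_def Frobenius_power_add[OF p char])
qed

text \<open>
  By Lagrange's theorem in the additive group, \<open>p ^ e\<close> annihilates 1. As an element of the ring this
  multiple of 1 is a power of \<open>p\<close> times 1, and a domain has no nonzero nilpotent elements.
\<close>
lemma (in domain) char_prime_of_card_prime_power:
  assumes card: "card (carrier R) = p ^ e"
  shows "[(p::nat)] \<cdot> \<one> = \<zero>"
proof -
  have "[(p ^ e)] \<cdot> \<one> = \<zero>"
    using add.pow_order_eq_1[of \<one>] card by (simp add: order_def)
  moreover have "[(p ^ n)] \<cdot> \<one> = ([p] \<cdot> \<one>) [^] n" for n :: nat
  proof (induction n)
    case (Suc n)
    have "[(p ^ Suc n)] \<cdot> \<one> = [p] \<cdot> ([(p ^ n)] \<cdot> \<one>)"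
      by (simp add: add.nat_pow_pow mult.commute)
    also have "\<dots> = [(p ^ n)] \<cdot> \<one> \<otimes> [p] \<cdot> \<one>"
      by (simp add: add_pow_rdistr)
    finally show ?case using Suc.IH by simp
  qed simp
  ultimately have "([p] \<cdot> \<one>) [^] e = \<zero>" by simp
  then show ?thesis
  proof (induction e)
    case (Suc e)
    then show ?case using integral[of "([p] \<cdot> \<one>) [^] e" "[p] \<cdot> \<one>"] by auto
  qed simp
qed


section \<open>The subfield and the trace\<close>

context field
begin

lemma pow_card_minus_one:
  assumes fin: "finite (carrier R)" and x: "x \<in> carrier R" "x \<noteq> \<zero>"
  shows "x [^] (card (carrier R) - 1) = \<one>"
proof -
  interpret G: group "Multiplicative_Group.mult_of R" by (rule field_mult_group)
  show ?thesis
    using G.pow_order_eq_1[of x] x order_mult_of[OF fin] by (simp add: Multiplicative_Group.mult_of_simps order_def)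
qed

lemma subfield_pow_card_minus_one:
  assumes fin: "finite (carrier R)" and K: "subfield K R" and a: "a \<in> K" "a \<noteq> \<zero>"
  shows "a [^] (card K - 1) = \<one>"
proof -
  interpret F: field "R\<lparr>carrier := K\<rparr>" by (rule subfield_iff(2)[OF K])
  have "finite K" using fin subfieldE(3)[OF K] by (rule rev_finite_subset)
  then show ?thesis
    using F.pow_card_minus_one[of a] a by (simp flip: nat_pow_consistent)
qed

lemma subfield_pow_card:
  assumes fin: "finite (carrier R)" and K: "subfield K R" and a: "a \<in> K"
  shows "a [^] card K = a"
proof -
  have aR: "a \<in> carrier R" using subfieldE(3)[OF K] a by auto
  have "card K > 0"
    using a fin subfieldE(3)[OF K] by (metis card_gt_0_iff empty_iff rev_finite_subset)
  then obtain r where r: "card K = Suc r" using gr0_implies_Suc by blast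
  show ?thesis
  proof (cases "a = \<zero>")
    case True
    then show ?thesis by (simp add: r)
  next
    case False
    then show ?thesis
      using subfield_pow_card_minus_one[OF fin K a False] aR by (simp add: r)
  qed
qed

text \<open>
  The converse of \<open>subfield_pow_card\<close>: the nonzero elements of \<open>K\<close> already account for \<open>card K - 1\<close>
  roots of \<open>X ^ (card K - 1) - 1\<close>, which is as many as its degree allows.
\<close>
lemma mem_subfield_of_pow_card:
  assumes fin: "finite (carrier R)" and K: "subfield K R"
    and x: "x \<in> carrier R" "x [^] card K = x"
  shows "x \<in> K"
proof (cases "x = \<zero>")
  case True
  then show ?thesis using subringE(2)[OF subfieldE(1)[OF K]] by simp
next
  case False
  let ?S = "{y \<in> carrier R. y [^] (card K - 1) = \<one>}"
  have finK: "finite K" using fin subfieldE(3)[OF K] by (rule rev_finite_subset)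
  have zo: "{\<zero>, \<one>} \<subseteq> K"
    using subringE(2,3)[OF subfieldE(1)[OF K]] by simp
  from card_mono[OF finK zo] have two: "2 \<le> card K" by simp
  have sub: "K - {\<zero>} \<subseteq> ?S"
    using subfield_pow_card_minus_one[OF fin K] subfieldE(3)[OF K] by auto
  have "card ?S \<le> card (K - {\<zero>})"
    using num_roots_le_deg[OF fin, of "card K - 1"] two zo finK by simp
  then have eq: "K - {\<zero>} = ?S"
    using sub fin by (intro card_seteq) auto
  obtain r where r: "card K = Suc r" using two by (cases "card K") auto
  have "x [^] r \<otimes> x = \<one> \<otimes> x" using x by (simp add: r)
  then have "x [^] (card K - 1) = \<one>"
    using x(1) False by (subst (asm) m_rcancel) (auto simp: r)
  then show ?thesis using eq x(1) by blast
qed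

lemma ff_trace_closed:
  "x \<in> carrier R \<Longrightarrow> ff_trace R q m x \<in> carrier R"
  unfolding ff_trace_def by (intro finsum_closed) auto

lemma ff_trace_mult_fixed:
  assumes a: "a \<in> carrier R" "a [^] q = a" and x: "x \<in> carrier R"
  shows "ff_trace R q m (a \<otimes> x) = a \<otimes> ff_trace R q m x"
proof -
  have "a [^] (q ^ i) = a" for i :: nat
  proof (induction i)
    case (Suc i)
    have "a [^] (q ^ Suc i) = (a [^] (q ^ i)) [^] q"
      using a(1) by (simp add: nat_pow_pow mult.commute)
    then show ?case using Suc.IH a(2) by simp
  qed (use a in simp)
  then show ?thesis
    using a(1) x by (simp add: ff_trace_def nat_pow_distrib finsum_rdistr Pi_def)
qed

text \<open>
  The Frobenius map sends each conjugate \<open>x ^ (q ^ i)\<close> to the next one and, since \<open>x ^ (q ^ m) = x\<close>, the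
  last one to the first. So it only permutes the summands of the trace.
\<close>
lemma ff_trace_pow_fixed:
  assumes p: "Factorial_Ring.prime (p::nat)" and char: "[p] \<cdot> \<one> = \<zero>" and q: "q = p ^ k"
    and x: "x \<in> carrier R" and fixed: "x [^] (q ^ m) = x"
  shows "ff_trace R q m x [^] q = ff_trace R q m x"
proof (cases m)
  case 0
  then show ?thesis
    using p by (simp add: ff_trace_def q nat_pow_zero prime_gt_0_nat)
next
  case (Suc n)
  define g where "g i = x [^] (q ^ i)" for i
  have g: "g i \<in> carrier R" for i
    using x by (simp add: g_def)
  have tr: "ff_trace R q m x = (\<Oplus>i\<in>{..n}. g i)"
    by (simp add: ff_trace_def g_def Suc lessThan_Suc_atMost)
  have "ff_trace R q m x [^] q = (\<Oplus>i\<in>{..n}. g i [^] q)"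
    using Frobenius_power_finsum[OF p char, of "{..n}" g k] g by (simp add: tr q[symmetric] Pi_def)
  also have "\<dots> = (\<Oplus>i\<in>{..n}. g (Suc i))"
    using x by (simp add: g_def nat_pow_pow mult.commute)
  finally have shift: "ff_trace R q m x [^] q = (\<Oplus>i\<in>{..n}. g (Suc i))" .
  have "(\<Oplus>i\<in>{..n}. g (Suc i)) \<oplus> g 0 = (\<Oplus>i\<in>{..Suc n}. g i)"
    using g by (subst add.finprod_Suc2) auto
  also have "\<dots> = g (Suc n) \<oplus> (\<Oplus>i\<in>{..n}. g i)"
    using g by simp
  also have "g (Suc n) = g 0"
    using fixed x by (simp add: g_def Suc)
  finally have "(\<Oplus>i\<in>{..n}. g (Suc i)) \<oplus> g 0 = (\<Oplus>i\<in>{..n}. g i) \<oplus> g 0"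
    using g by (simp add: a_comm)
  then have "(\<Oplus>i\<in>{..n}. g (Suc i)) = (\<Oplus>i\<in>{..n}. g i)"
    using g by (simp add: add.r_cancel Pi_def)
  with shift tr show ?thesis by metis
qed

lemma ff_trace_mem_subfield:
  assumes q: "primepow q" and card: "card (carrier R) = q ^ m"
    and K: "subfield K R" and cardK: "card K = q" and x: "x \<in> carrier R"
  shows "ff_trace R q m x \<in> K"
proof -
  from q obtain p k where p: "Factorial_Ring.prime (p::nat)" and qp: "q = p ^ k"
    by (auto simp: primepow_def)
  have fin: "finite (carrier R)"
    using card p qp by (intro card_ge_0_finite) (simp add: prime_gt_0_nat)
  have char: "[p] \<cdot> \<one> = \<zero>"
    using card by (intro char_prime_of_card_prime_power[of p "k * m"]) (simp add: qp power_mult)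
  have "x [^] (q ^ m) = x"
    using subfield_pow_card[OF fin carrier_is_subfield x] card by simp
  then show ?thesis
    using ff_trace_pow_fixed[OF p char qp x] ff_trace_closed[OF x] cardK
    by (intro mem_subfield_of_pow_card[OF fin K]) auto
qed


section \<open>N-free elements as powers of a primitive element\<close>

text \<open>
  The exponents are enumerated from 1 to \<open>card (carrier R) - 1\<close>, in accordance with
  \<open>card_coprime_upto_multiple\<close>; the identity is the last power in this list.
\<close>
lemma finite_field_generator:
  assumes fin: "finite (carrier R)"
  obtains \<alpha> where "\<alpha> \<in> carrier R" "\<alpha> \<noteq> \<zero>"
    and "\<And>n::nat. \<alpha> [^] n = \<one> \<longleftrightarrow> card (carrier R) - 1 dvd n"
    and "bij_betw (\<lambda>n::nat. \<alpha> [^] n) {0<..card (carrier R) - 1} (carrier R - {\<zero>})"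
proof -
  interpret G: group "Multiplicative_Group.mult_of R"
    rewrites "([^]\<^bsub>Multiplicative_Group.mult_of R\<^esub>) = (([^]) :: _ \<Rightarrow> nat \<Rightarrow> _)" and "\<one>\<^bsub>Multiplicative_Group.mult_of R\<^esub> = \<one>"
      and "carrier (Multiplicative_Group.mult_of R) = carrier R - {\<zero>}"
    by (rule field_mult_group) (simp_all add: Multiplicative_Group.mult_of_simps)
  obtain \<alpha> where \<alpha>: "\<alpha> \<in> carrier R - {\<zero>}"
    and gen: "carrier R - {\<zero>} = {\<alpha> [^] i | i::nat. i \<in> UNIV}"
    using finite_field_mult_group_has_gen[OF fin] by auto
  let ?n = "G.ord \<alpha>"
  have "1 \<le> ?n" using G.ord_ge_1[of \<alpha>] fin \<alpha> by auto
  have img: "(\<lambda>n. \<alpha> [^] n) ` {0<..?n} = carrier R - {\<zero>}"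
  proof (intro equalityI subsetI)
    fix y assume "y \<in> carrier R - {\<zero>}"
    moreover have "carrier R - {\<zero>} = {\<alpha> [^] i | i. i \<in> {0..?n - 1}}"
      using gen G.ord_elems[of \<alpha>] fin \<alpha> by (metis finite_Diff)
    ultimately have "y \<in> {\<alpha> [^] i | i. i \<in> {0..?n - 1}}" by simp
    then obtain i :: nat where y: "y = \<alpha> [^] i" "i \<le> ?n - 1" by auto
    show "y \<in> (\<lambda>n. \<alpha> [^] n) ` {0<..?n}"
    proof (cases "i = 0")
      case True
      then have "y = \<alpha> [^] ?n" using y \<alpha> by simp
      then show ?thesis using \<open>1 \<le> ?n\<close> by auto
    qed (use y in auto)
  qed (use gen in auto)
  have inj: "inj_on (\<lambda>n. \<alpha> [^] n) {0<..?n}"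
    using G.ord_inj'[of \<alpha>] \<alpha> by (simp add: atLeastSucAtMost_greaterThanAtMost)
  have "?n = card (carrier R) - 1"
    using card_image[OF inj] img by (simp add: card_Diff_singleton fin)
  with that[of \<alpha>] \<alpha> img inj G.pow_eq_id[of \<alpha>] show thesis
    by (simp add: bij_betw_def)
qed

text \<open>
  The exponent of a power of a primitive element is determined only modulo the order \<open>M\<close> of the group,
  which is enough to decide its divisibility by the divisors of \<open>M\<close>.
\<close>
lemma generator_pow_eq_imp_dvd_iff:
  fixes i j d :: nat
  assumes \<alpha>: "\<alpha> \<in> carrier R" "\<alpha> \<noteq> \<zero>"
    and ord: "\<And>n::nat. \<alpha> [^] n = \<one> \<longleftrightarrow> M dvd n"
    and eq: "\<alpha> [^] i = \<alpha> [^] j" and d: "d dvd M"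
  shows "d dvd i \<longleftrightarrow> d dvd j"
  using eq
proof (induction i j rule: linorder_wlog)
  case (le i j)
  have "\<alpha> [^] i \<otimes> \<alpha> [^] (j - i) = \<alpha> [^] (i + (j - i))"
    using \<alpha>(1) by (rule nat_pow_mult)
  also have "i + (j - i) = j" using le(1) by simp
  also have "\<alpha> [^] j = \<alpha> [^] i \<otimes> \<one>" using le(2) \<alpha>(1) by simp
  finally have "\<alpha> [^] i \<otimes> \<alpha> [^] (j - i) = \<alpha> [^] i \<otimes> \<one>" .
  moreover have "\<alpha> [^] i \<noteq> \<zero>" using \<alpha> by (induction i) (auto simp: integral_iff)
  ultimately have "\<alpha> [^] (j - i) = \<one>"
    using \<alpha>(1) by (subst (asm) m_lcancel) auto
  with ord d have "d dvd j - i" by (meson dvd_trans)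
  then show ?case using le(1) by (metis dvd_diffD1 dvd_diffD le_add_diff_inverse dvd_add_right_iff dvd_add_left_iff)
qed simp

text \<open>
  If \<open>d\<close> divides both \<open>k\<close> and \<open>N\<close>, then \<open>\<alpha> ^ k\<close> is visibly a \<open>d\<close>-th power. Conversely \<open>\<alpha> ^ k = \<gamma> ^ d\<close> with
  \<open>\<gamma> = \<alpha> ^ j\<close> makes \<open>k\<close> congruent to \<open>j d\<close> modulo \<open>M\<close>, so that \<open>d\<close>, as a divisor of \<open>M\<close>, divides \<open>k\<close>.
\<close>
lemma N_free_generator_pow_iff:
  assumes \<alpha>: "\<alpha> \<in> carrier R" "\<alpha> \<noteq> \<zero>"
    and ord: "\<And>n::nat. \<alpha> [^] n = \<one> \<longleftrightarrow> M dvd n"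
    and gen: "\<And>\<gamma>. \<gamma> \<in> carrier R - {\<zero>} \<Longrightarrow> \<exists>j::nat. \<gamma> = \<alpha> [^] j"
    and N: "0 < N" "N dvd M"
  shows "N_free R N (\<alpha> [^] (k::nat)) \<longleftrightarrow> coprime k N"
proof
  have nz: "\<alpha> [^] (k::nat) \<noteq> \<zero>" for k
    using \<alpha> by (induction k) (auto simp: integral_iff)
  show "coprime k N" if free: "N_free R N (\<alpha> [^] k)"
  proof -
    have "\<alpha> [^] k = (\<alpha> [^] (k div gcd k N)) [^] gcd k N"
      using \<alpha>(1) by (simp add: nat_pow_pow)
    then have "gcd k N = 1"
      using free \<alpha>(1) unfolding N_free_def by (metis gcd_dvd2 nat_pow_closed)
    then show ?thesis by (simp add: coprime_iff_gcd_eq_1)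
  qed
  show "N_free R N (\<alpha> [^] k)" if cop: "coprime k N"
    unfolding N_free_def
  proof (intro conjI allI ballI impI)
    fix d :: nat and \<gamma>
    assume \<gamma>: "\<gamma> \<in> carrier R" and d: "d dvd N" and eq: "\<alpha> [^] k = \<gamma> [^] d"
    have "d > 0" using d N(1) by (rule dvd_pos_nat[rotated])
    have "\<gamma> \<noteq> \<zero>"
      using eq nz[of k] \<open>d > 0\<close> by (auto simp: nat_pow_zero)
    then obtain j :: nat where "\<gamma> = \<alpha> [^] j" using gen \<gamma> by blast
    then have "\<alpha> [^] k = \<alpha> [^] (j * d)"
      using eq \<alpha>(1) by (simp add: nat_pow_pow)
    from generator_pow_eq_imp_dvd_iff[OF \<alpha> ord this, of d] d N(2) have "d dvd k"
      using dvd_trans by auto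
    then show "d = 1" using cop d by (metis coprime_common_divisor_nat)
  qed (use \<alpha>(1) nz in auto)
qed

lemma card_N_free:
  assumes fin: "finite (carrier R)" and N: "0 < N" "N dvd card (carrier R) - 1"
  shows "card {x \<in> carrier R. N_free R N x} = (card (carrier R) - 1) div N * totient N"
proof -
  let ?M = "card (carrier R) - 1"
  obtain \<alpha> where \<alpha>: "\<alpha> \<in> carrier R" "\<alpha> \<noteq> \<zero>"
    and ord: "\<And>n::nat. \<alpha> [^] n = \<one> \<longleftrightarrow> ?M dvd n"
    and bij: "bij_betw (\<lambda>n::nat. \<alpha> [^] n) {0<..?M} (carrier R - {\<zero>})"
    using finite_field_generator[OF fin] by metis
  have gen: "\<exists>j::nat. \<gamma> = \<alpha> [^] j" if "\<gamma> \<in> carrier R - {\<zero>}" for \<gamma>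
    using that bij by (auto simp: bij_betw_def)
  note free_iff = N_free_generator_pow_iff[OF \<alpha> ord gen N]
  have img: "carrier R - {\<zero>} = (\<lambda>n. \<alpha> [^] n) ` {0<..?M}"
    using bij by (simp add: bij_betw_def)
  have "{x \<in> carrier R. N_free R N x} = {x \<in> carrier R - {\<zero>}. N_free R N x}"
    by (auto simp: N_free_def)
  also have "\<dots> = (\<lambda>n. \<alpha> [^] n) ` {k \<in> {0<..?M}. coprime k N}"
    unfolding img using free_iff by auto
  also have "card \<dots> = card {k \<in> {0<..?M}. coprime k N}"
    by (rule card_image[OF inj_on_subset[OF bij_betw_imp_inj_on[OF bij]]]) auto
  also have "\<dots> = ?M div N * totient N"
    using card_coprime_upto_multiple[of N "?M div N"] N(2) by simp
  finally show ?thesis .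
qed

text \<open>
  Nonzero elements of \<open>K\<close> are \<open>Q\<close>-th powers, where \<open>Q\<close> is the index of \<open>K - {0}\<close> in the multiplicative
  group. If all primes of \<open>N\<close> divide \<open>Q\<close>, such a factor changes the exponent of a primitive element by
  a multiple of the radical of \<open>N\<close>.
\<close>
lemma N_free_subfield_mult:
  assumes fin: "finite (carrier R)" and K: "subfield K R"
    and N: "0 < N" "N dvd card (carrier R) - 1"
    and primes: "\<And>p::nat. Factorial_Ring.prime p \<Longrightarrow> p dvd N
      \<Longrightarrow> p dvd (card (carrier R) - 1) div (card K - 1)"
    and card_dvd: "card K - 1 dvd card (carrier R) - 1"
    and a: "a \<in> K - {\<zero>}" and x: "N_free R N x"
  shows "N_free R N (a \<otimes> x)"
proof -
  let ?M = "card (carrier R) - 1" and ?Q = "(card (carrier R) - 1) div (card K - 1)"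
  obtain \<alpha> where \<alpha>: "\<alpha> \<in> carrier R" "\<alpha> \<noteq> \<zero>"
    and ord: "\<And>n::nat. \<alpha> [^] n = \<one> \<longleftrightarrow> ?M dvd n"
    and bij: "bij_betw (\<lambda>n::nat. \<alpha> [^] n) {0<..?M} (carrier R - {\<zero>})"
    using finite_field_generator[OF fin] by metis
  have gen: "\<exists>j::nat. \<gamma> = \<alpha> [^] j" if "\<gamma> \<in> carrier R - {\<zero>}" for \<gamma>
    using that bij by (auto simp: bij_betw_def)
  note free_iff = N_free_generator_pow_iff[OF \<alpha> ord gen N]
  obtain i :: nat where i: "a = \<alpha> [^] i"
    using gen a subfieldE(3)[OF K] by blast
  obtain k :: nat where k: "x = \<alpha> [^] k"
    using gen[of x] x unfolding N_free_def by blast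
  have "card {\<zero>, \<one>} \<le> card (carrier R)"
    using fin by (intro card_mono) auto
  then have "?M > 0" by simp
  have "\<alpha> [^] (i * (card K - 1)) = \<one>"
    using subfield_pow_card_minus_one[OF fin K, of a] a \<alpha>(1) by (simp add: i nat_pow_pow)
  then have "?Q * (card K - 1) dvd i * (card K - 1)"
    using ord card_dvd by simp
  moreover have "card K - 1 \<noteq> 0"
    using card_dvd \<open>?M > 0\<close> by (metis dvd_0_left_iff less_numeral_extra(3))
  ultimately have Q: "?Q dvd i" by simp
  have "coprime k N" using x k free_iff by simp
  have "coprime (i + k) N"
  proof (rule ccontr)
    assume "\<not> coprime (i + k) N"
    then have "gcd (i + k) N \<noteq> 1" by (simp add: coprime_iff_gcd_eq_1)
    then obtain p where p: "Factorial_Ring.prime p" "p dvd i + k" "p dvd N"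
      using prime_factor_nat[of "gcd (i + k) N"] by auto
    then have "p dvd i" using primes Q dvd_trans by blast
    then have "p dvd k" using p(2) by (simp add: dvd_add_right_iff)
    then show False
      using p \<open>coprime k N\<close> by (meson coprime_common_divisor not_prime_unit)
  qed
  then show ?thesis
    using free_iff[of "i + k"] \<alpha>(1) by (simp add: i k nat_pow_mult)
qed

end


section \<open>The number of N-free elements of given trace\<close>

theorem theorem1p11:
  fixes L :: "('a, 'b) ring_scheme" and K :: "'a set" and q m N :: nat and c :: 'a
  assumes "primepow q" and "0 < m"
    and "field L" and "card (carrier L) = q ^ m"
    and "subfield K L" and "card K = q"
    and "0 < N" and "N dvd q ^ m - 1"
    and "\<forall>p::nat. Factorial_Ring.prime p \<longrightarrow> p dvd N \<longrightarrow> p dvd (q ^ m - 1) div (q - 1)"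
    and "c \<in> K - {\<zero>\<^bsub>L\<^esub>}"
  shows "real (Z_free L q m N c) =
    ((real q ^ m - 1) / real N * real (totient N) - real (Z_free L q m N \<zero>\<^bsub>L\<^esub>)) / (real q - 1)"
proof -
  interpret field L by fact
  note card = assms(4) and K = assms(5) and cardK = assms(6) and N = assms(7,8) and c = assms(10)
  have q: "q > 1" using primepow_gt_Suc_0[OF assms(1)] by simp
  have fin: "finite (carrier L)"
    using card q by (intro card_ge_0_finite) simp
  have KL: "K \<subseteq> carrier L" by (rule subfieldE(3)[OF K])
  have finK: "finite K" using fin KL by (rule rev_finite_subset)
  have q_dvd: "q - 1 dvd q ^ m - 1"
  proof (induction m)
    case (Suc m)
    have "q ^ Suc m - 1 = q * (q ^ m - 1) + (q - 1)"
      using q by (simp add: algebra_simps)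
    then show ?case using Suc.IH by simp
  qed simp
  define S where "S b = {\<xi> \<in> carrier L. N_free L N \<xi> \<and> ff_trace L q m \<xi> = b}" for b
  have finS: "finite (S b)" for b using fin by (simp add: S_def)
  have Z: "Z_free L q m N b = card (S b)" for b by (simp add: Z_free_def S_def)

  (* Multiplication by a embeds the fibre of the trace over b into the fibre over a b; applied to
     quotients of nonzero elements of K this compares any two nonzero fibres in both directions. *)
  have le: "card (S b) \<le> card (S (a \<otimes>\<^bsub>L\<^esub> b))" if a: "a \<in> K - {\<zero>\<^bsub>L\<^esub>}" for a b
  proof (rule card_inj_on_le[where f = "\<lambda>\<xi>. a \<otimes>\<^bsub>L\<^esub> \<xi>"])
    have aL: "a \<in> carrier L" using a KL by auto
    show "inj_on (\<lambda>\<xi>. a \<otimes>\<^bsub>L\<^esub> \<xi>) (S b)"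
      using a aL by (auto simp: inj_on_def S_def m_lcancel)
    have "a [^]\<^bsub>L\<^esub> q = a" using subfield_pow_card[OF fin K] a cardK by simp
    then show "(\<lambda>\<xi>. a \<otimes>\<^bsub>L\<^esub> \<xi>) ` S b \<subseteq> S (a \<otimes>\<^bsub>L\<^esub> b)"
      using N_free_subfield_mult[OF fin K _ _ _ _ a] N assms(9) q_dvd card cardK aL
      by (auto simp: S_def ff_trace_mult_fixed)
  qed (rule finS)

  have le': "card (S b) \<le> card (S b')" if b: "b \<in> K - {\<zero>\<^bsub>L\<^esub>}" and b': "b' \<in> K - {\<zero>\<^bsub>L\<^esub>}" for b b'
  proof -
    have inv: "inv\<^bsub>L\<^esub> b \<in> K - {\<zero>\<^bsub>L\<^esub>}" "inv\<^bsub>L\<^esub> b \<otimes>\<^bsub>L\<^esub> b = \<one>\<^bsub>L\<^esub>"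
      using subfield_m_inv[OF K b] by auto
    have mem: "b \<in> carrier L" "b' \<in> carrier L" "inv\<^bsub>L\<^esub> b \<in> carrier L"
      using b b' inv KL by auto
    have "b' \<otimes>\<^bsub>L\<^esub> inv\<^bsub>L\<^esub> b \<in> K - {\<zero>\<^bsub>L\<^esub>}"
      using b' inv mem subringE(6)[OF subfieldE(1)[OF K]] by (auto simp: integral_iff)
    from le[OF this, of b] show ?thesis using mem inv by (simp add: m_assoc)
  qed
  have const: "card (S b) = card (S c)" if "b \<in> K - {\<zero>\<^bsub>L\<^esub>}" for b
    using le'[OF that c] le'[OF c that] by simp

  have "{\<xi> \<in> carrier L. N_free L N \<xi>} = (\<Union>b\<in>K. S b)"
    using ff_trace_mem_subfield[OF assms(1) card K cardK] by (auto simp: S_def)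
  then have "card {\<xi> \<in> carrier L. N_free L N \<xi>} = (\<Sum>b\<in>K. card (S b))"
    using finK finS by (subst card_UN_disjoint[symmetric]) (auto simp: S_def)
  also have "\<dots> = card (S \<zero>\<^bsub>L\<^esub>) + (\<Sum>b\<in>K - {\<zero>\<^bsub>L\<^esub>}. card (S b))"
    using finK subringE(2)[OF subfieldE(1)[OF K]] by (simp add: sum.remove)
  also have "(\<Sum>b\<in>K - {\<zero>\<^bsub>L\<^esub>}. card (S b)) = (q - 1) * card (S c)"
    using const finK subringE(2)[OF subfieldE(1)[OF K]] cardK by simp
  finally have "(q ^ m - 1) div N * totient N = card (S \<zero>\<^bsub>L\<^esub>) + (q - 1) * card (S c)"
    using card_N_free[OF fin N(1)] N(2) card by simp
  then have "real ((q ^ m - 1) div N * totient N) = real (card (S \<zero>\<^bsub>L\<^esub>) + (q - 1) * card (S c))"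
    by simp
  moreover have "real ((q ^ m - 1) div N) = (real q ^ m - 1) / real N"
    using N(2) q by (simp add: real_of_nat_div of_nat_diff)
  ultimately have "(real q ^ m - 1) / real N * real (totient N)
      = real (card (S \<zero>\<^bsub>L\<^esub>)) + (real q - 1) * real (card (S c))"
    using q by (simp add: of_nat_diff)
  then show ?thesis
    using q by (simp add: Z field_simps)
qed

end
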